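(* The set $\operatorname{Sort}(\operatorname{SC}_{12})$ is equal to the permutation class $\operatorname{Av}(213)$, while $\operatorname{Sort}(\operatorname{SC}_{21})$ is not a permutation class. If $\sigma\in S_k$ for some $k\geq 3$, then $\operatorname{Sort}(\operatorname{SC}_\sigma)$ is a permutation class if and only if both $\sigma$ and $\widehat\sigma$ contain the pattern $231$ classically; in this case $\operatorname{Sort}(\operatorname{SC}_\sigma)=\operatorname{Av}(132)$.
   Context: $S_n$ is the set of permutations of $[n]=\{1,\dots,n\}$, written in one-line notation. Two sequences of distinct integers have the same relative order if replacing the $i$th smallest entry of each by $i$ yields the same word. A permutation $\tau$ contains $\sigma$ classically if some (not necessarily consecutive) subsequence of $\tau$ has the same relative order as $\sigma$, and contains $\sigma$ consecutively if some consecutive subsequence does; otherwise $\tau$ avoids $\sigma$ classically/consecutively. $\operatorname{Av}(\tau^{(1)},\dots)$ denotes the set of all permutations (of all lengths $n\ge 0$) avoiding the listed patterns classically. For a set $\mathcal A$ of permutations, the map $T_{\mathcal A}:S_n\to S_n$ is defined as follows: send $\pi=\pi_1\cdots\pi_n$ through a stack; at each step, if there is a next input entry and placing it on top of the stack would make the stack contents, read from top to bottom, have the same relative order as some element of $\mathcal A$, push it; otherwise pop the top entry of the stack and append it to the end of the output. Stop when the output has length $n$; $T_{\mathcal A}(\pi)$ is the output. For a permutation $\sigma$, $\operatorname{SC}_\sigma=T_{\mathcal A}$ where $\mathcal A$ is the set of permutations avoiding $\sigma$ consecutively. $\operatorname{Sort}(\operatorname{SC}_\sigma)=\operatorname{SC}_\sigma^{-1}(\operatorname{Av}(231))$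 is the set of permutations $\pi$ (of any length) such that $\operatorname{SC}_\sigma(\pi)$ avoids $231$ classically. For $\sigma=\sigma_1\sigma_2\sigma_3\cdots\sigma_k$, $\widehat\sigma=\sigma_2\sigma_1\sigma_3\cdots\sigma_k$. A permutation class is a set of permutations closed under classical pattern containment (if $\sigma$ is in the set and $\sigma$ contains $\tau$ classically then $\tau$ is in the set). *)

theory Defs
  imports "HOL-Combinatorics.Multiset_Permutations" "HOL-Library.Sublist"
begin

definition Sym :: "nat \<Rightarrow> nat list set" where
  "Sym n = permutations_of_set {1..n}"

definition perms :: "nat list set" where
  "perms = (\<Union>n. Sym n)"

(* For a list of distinct entries, the i-th smallest entry is the one with exactly i entries below
   or equal to it. *)
definition standardize :: "nat list \<Rightarrow> nat list" where
  "standardize xs = map (\<lambda>x. card {y \<in> set xs. y \<le> x}) xs"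

definition same_order :: "nat list \<Rightarrow> nat list \<Rightarrow> bool" where
  "same_order xs ys \<longleftrightarrow> standardize xs = standardize ys"

definition contains :: "nat list \<Rightarrow> nat list \<Rightarrow> bool" where
  "contains \<tau> \<sigma> \<longleftrightarrow> (\<exists>zs. subseq zs \<tau> \<and> same_order zs \<sigma>)"

definition contains_consec :: "nat list \<Rightarrow> nat list \<Rightarrow> bool" where
  "contains_consec \<tau> \<sigma> \<longleftrightarrow> (\<exists>zs. sublist zs \<tau> \<and> same_order zs \<sigma>)"

definition Av :: "nat list set \<Rightarrow> nat list set" where
  "Av P = {\<pi> \<in> perms. \<forall>\<sigma>\<in>P. \<not> contains \<pi> \<sigma>}"

definition perm_class :: "nat list set \<Rightarrow> bool" where
  "perm_class C \<longleftrightarrow>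
     C \<subseteq> perms \<and> (\<forall>\<sigma>\<in>C. \<forall>\<tau>\<in>perms. contains \<sigma> \<tau> \<longrightarrow> \<tau> \<in> C)"

(* stack_run A input stack: the entries still to be output from this configuration; the head of the
   stack list is the top of the stack. If the stack is empty and the next entry may not be pushed,
   the procedure is undefined; this cannot happen when A contains the permutation [1], as it does
   for every map SC s with s of length at least 2, and the value [] is then arbitrary. *)
function stack_run :: "nat list set \<Rightarrow> nat list \<Rightarrow> nat list \<Rightarrow> nat list" where
  "stack_run A [] [] = []"
| "stack_run A [] (s # st) = s # stack_run A [] st"
| "stack_run A (x # inp) st =
     (if \<exists>\<tau>\<in>A. same_order (x # st) \<tau> then stack_run A inp (x # st)
      else (case st of [] \<Rightarrow> [] | s # st' \<Rightarrow> s # stack_run A (x # inp) st'))"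
  by pat_completeness auto
termination
  by (relation "measure (\<lambda>(A, inp, st). 2 * length inp + length st)") auto

definition T :: "nat list set \<Rightarrow> nat list \<Rightarrow> nat list" where
  "T A \<pi> = stack_run A \<pi> []"

definition SC :: "nat list \<Rightarrow> nat list \<Rightarrow> nat list" where
  "SC \<sigma> = T {\<tau> \<in> perms. \<not> contains_consec \<tau> \<sigma>}"

definition Sort :: "(nat list \<Rightarrow> nat list) \<Rightarrow> nat list set" where
  "Sort f = {\<pi> \<in> perms. f \<pi> \<in> Av {[2, 3, 1]}}"

fun swap_first_two :: "nat list \<Rightarrow> nat list" where
  "swap_first_two (a # b # xs) = b # a # xs"
| "swap_first_two xs = xs"

end

theory Submission
  imports Defs
begin

text \<open>If the stack never refuses an entry, the output is the reverse of the input. Otherwise, at the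
  last pop before a refused entry is pushed, the popped entry, the refused one and the entries below
  them leave the stack in an order that forms \<open>\<sigma>\<close> with its first two entries swapped. Hence the
  output avoids 231 precisely when the input avoids 132, provided both \<open>\<sigma>\<close> and its swapped version
  contain 231. In all other cases a word and one of its patterns are exhibited such that only the
  larger word is sortable; for \<open>k \<ge> 3\<close> the larger word is the reverse of \<open>\<sigma>\<close> with at most two
  entries inserted.

  For \<open>\<sigma> = 12\<close> the output always ends with its minimum, so it avoids 231 if and only if it is
  decreasing.\<close>

section \<open>Relative order\<close>

lemma standardize_map:
  assumes "strict_mono_on (set xs) f"
  shows "standardize (map f xs) = standardize xs"
proof -
  have "card {y \<in> f ` set xs. y \<le> f x} = card {y \<in> set xs. y \<le> x}" if x: "x \<in> set xs" for x
  proof -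
    have "{y \<in> f ` set xs. y \<le> f x} = f ` {y \<in> set xs. y \<le> x}"
      using strict_mono_on_less_eq[OF assms] x by auto
    moreover have "inj_on f {y \<in> set xs. y \<le> x}"
      using strict_mono_on_imp_inj_on[OF assms] by (rule inj_on_subset) auto
    ultimately show ?thesis by (simp add: card_image)
  qed
  then show ?thesis by (simp add: standardize_def)
qed

text \<open>The rank function is strictly increasing on the entries, because the set of entries up
  to \<open>x\<close> grows strictly with \<open>x\<close>.\<close>

lemma standardize_strict_mono_map:
  obtains g where "strict_mono_on (set xs) g" "standardize xs = map g xs"
proof
  show "strict_mono_on (set xs) (\<lambda>x. card {y \<in> set xs. y \<le> x})"
    by (rule strict_mono_onI, rule psubset_card_mono) force+
qed (simp add: standardize_def)

lemma same_order_refl [simp]: "same_order xs xs"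
  by (simp add: same_order_def)

lemma same_order_sym: "same_order xs ys \<Longrightarrow> same_order ys xs"
  by (simp add: same_order_def)

lemma same_order_trans: "same_order xs ys \<Longrightarrow> same_order ys zs \<Longrightarrow> same_order xs zs"
  by (simp add: same_order_def)

lemma same_order_map: "strict_mono_on (set xs) f \<Longrightarrow> same_order (map f xs) xs"
  by (simp add: same_order_def standardize_map)

lemma same_order_length: "same_order xs ys \<Longrightarrow> length xs = length ys"
  by (metis same_order_def standardize_def length_map)

lemma same_order_standardize: "same_order (standardize xs) xs"
  by (metis same_order_map standardize_strict_mono_map)

lemma same_order_iff_nth:
  "same_order xs ys \<longleftrightarrow> length xs = length ys \<and>
     (\<forall>i<length xs. \<forall>j<length xs. xs ! i < xs ! j \<longleftrightarrow> ys ! i < ys ! j)"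
proof
  assume so: "same_order xs ys"
  then have len: "length xs = length ys" by (rule same_order_length)
  obtain g where g: "strict_mono_on (set xs) g" "standardize xs = map g xs"
    by (rule standardize_strict_mono_map)
  obtain h where h: "strict_mono_on (set ys) h" "standardize ys = map h ys"
    by (rule standardize_strict_mono_map)
  have "xs ! i < xs ! j \<longleftrightarrow> ys ! i < ys ! j" if "i < length xs" "j < length xs" for i j
  proof -
    have "map g xs = map h ys" using so g h by (simp add: same_order_def)
    then have "g (xs ! i) = h (ys ! i)" "g (xs ! j) = h (ys ! j)"
      using that len by (metis nth_map)+
    moreover have "xs ! i < xs ! j \<longleftrightarrow> g (xs ! i) < g (xs ! j)"
      using strict_mono_on_less[OF g(1)] that by simp
    moreover have "ys ! i < ys ! j \<longleftrightarrow> h (ys ! i) < h (ys ! j)"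
      using strict_mono_on_less[OF h(1)] that len by simp
    ultimately show ?thesis by simp
  qed
  with len show "length xs = length ys \<and>
     (\<forall>i<length xs. \<forall>j<length xs. xs ! i < xs ! j \<longleftrightarrow> ys ! i < ys ! j)" by blast
next
  assume R: "length xs = length ys \<and>
     (\<forall>i<length xs. \<forall>j<length xs. xs ! i < xs ! j \<longleftrightarrow> ys ! i < ys ! j)"
  define f where "f x = ys ! (SOME i. i < length xs \<and> xs ! i = x)" for x
  have f: "f (xs ! i) = ys ! i" if i: "i < length xs" for i
  proof -
    define j where "j = (SOME j. j < length xs \<and> xs ! j = xs ! i)"
    have "j < length xs \<and> xs ! j = xs ! i"
      unfolding j_def by (rule someI[of _ i]) (simp add: i)
    then have "ys ! j = ys ! i" using R i by (metis nat_neq_iff)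
    then show ?thesis by (simp add: f_def j_def)
  qed
  have "strict_mono_on (set xs) f"
    using R f by (intro strict_mono_onI) (metis in_set_conv_nth)
  moreover have "map f xs = ys" using R f by (intro nth_equalityI) auto
  ultimately show "same_order xs ys" using same_order_map same_order_sym by metis
qed

lemma same_order_Nil [simp]: "same_order [] ys \<longleftrightarrow> ys = []" "same_order xs [] \<longleftrightarrow> xs = []"
  by (auto simp: same_order_iff_nth)

text \<open>As a simp rule this reduces comparing explicit words to comparing entries; the concrete
  runs below are evaluated with it.\<close>

lemma same_order_Cons [simp]:
  "same_order (x # xs) (y # ys) \<longleftrightarrow>
     list_all2 (\<lambda>a b. (x < a \<longleftrightarrow> y < b) \<and> (a < x \<longleftrightarrow> b < y)) xs ys \<and> same_order xs ys"
  by (auto simp: same_order_iff_nth list_all2_conv_all_nth All_less_Suc2)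

lemma same_order_rev [simp]: "same_order (rev xs) (rev ys) \<longleftrightarrow> same_order xs ys"
proof -
  have "same_order (rev xs) (rev ys)" if "same_order xs ys" for xs ys
    using that by (auto simp: same_order_iff_nth rev_nth)
  from this[of xs ys] this[of "rev xs" "rev ys"] show ?thesis by auto
qed

lemma same_order_take: "same_order xs ys \<Longrightarrow> same_order (take n xs) (take n ys)"
  by (auto simp: same_order_iff_nth)

lemma same_order_drop: "same_order xs ys \<Longrightarrow> same_order (drop n xs) (drop n ys)"
  by (auto simp: same_order_iff_nth)

lemma same_order_obtain_map:
  assumes "same_order xs ys"
  obtains f where "strict_mono_on (set xs) f" "ys = map f xs"
proof -
  obtain g where g: "strict_mono_on (set xs) g" "standardize xs = map g xs"
    by (rule standardize_strict_mono_map)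
  obtain h where h: "strict_mono_on (set ys) h" "standardize ys = map h ys"
    by (rule standardize_strict_mono_map)
  have eq: "map g xs = map h ys" using assms g h by (simp add: same_order_def)
  define f where "f x = the_inv_into (set ys) h (g x)" for x
  have inj: "inj_on h (set ys)" by (rule strict_mono_on_imp_inj_on[OF h(1)])
  have img: "g ` set xs = h ` set ys" using arg_cong[OF eq, of set] by simp
  have hf: "h (f x) = g x" "f x \<in> set ys" if "x \<in> set xs" for x
  proof -
    have "g x \<in> h ` set ys" using that img by blast
    then show "h (f x) = g x" "f x \<in> set ys" unfolding f_def
      by (auto intro: f_the_inv_into_f[OF inj] the_inv_into_into[OF inj _ order_refl])
  qed
  have "strict_mono_on (set xs) f"
    by (rule strict_mono_onI) (metis g(1) h(1) hf strict_mono_on_less)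
  moreover have "ys = map f xs"
  proof (rule nth_equalityI)
    show "length ys = length (map f xs)" using assms by (simp add: same_order_length)
    fix i assume i: "i < length ys"
    then have i': "i < length xs" using assms by (simp add: same_order_length)
    have "h (ys ! i) = h (f (xs ! i))" using eq i i' hf(1) by (metis nth_map nth_mem)
    then show "ys ! i = map f xs ! i" using inj i i' hf(2) by (simp add: inj_on_eq_iff)
  qed
  ultimately show thesis by (rule that)
qed

lemma standardize_distinct: "distinct xs \<Longrightarrow> distinct (standardize xs)"
  by (metis distinct_map standardize_strict_mono_map strict_mono_on_imp_inj_on)

text \<open>The ranks are distinct and lie between 1 and the length, so by counting they fill that
  interval.\<close>

lemma permsI_standardize:
  assumes "distinct xs"
  shows "standardize xs \<in> perms"
proof -
  have "set (standardize xs) \<subseteq> {1..length xs}"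
  proof
    fix c assume "c \<in> set (standardize xs)"
    then obtain x where x: "x \<in> set xs" "c = card {y \<in> set xs. y \<le> x}"
      by (auto simp: standardize_def)
    have "0 < c" using x by (auto simp: card_gt_0_iff)
    moreover have "c \<le> card (set xs)" unfolding x(2) by (rule card_mono) auto
    ultimately show "c \<in> {1..length xs}" using card_length[of xs] by auto
  qed
  moreover have "card (set (standardize xs)) = length xs"
    using standardize_distinct[OF assms] by (metis distinct_card length_map standardize_def)
  ultimately have "set (standardize xs) = {1..length xs}"
    by (intro card_subset_eq) auto
  then have "standardize xs \<in> Sym (length xs)"
    using standardize_distinct[OF assms] by (simp add: Sym_def permutations_of_set_def)
  then show ?thesis by (auto simp: perms_def)
qed

lemma standardize_Sym:
  assumes "xs \<in> Sym n"
  shows "standardize xs = xs"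
proof -
  have s: "set xs = {1..n}" using assms by (simp add: Sym_def permutations_of_set_def)
  have "card {y \<in> set xs. y \<le> x} = x" if "x \<in> set xs" for x
  proof -
    have "{y \<in> set xs. y \<le> x} = {1..x}" using that s by auto
    then show ?thesis by simp
  qed
  then show ?thesis by (simp add: standardize_def map_idI)
qed

section \<open>Pattern containment\<close>

lemma contains_refl: "contains xs xs"
  using contains_def by auto

lemma set_subseq: "subseq xs ys \<Longrightarrow> set xs \<subseteq> set ys"
  by (auto dest: list_emb_set)

lemma contains_same_order:
  assumes "contains xs p" "same_order xs ys"
  shows "contains ys p"
proof -
  obtain zs where zs: "subseq zs xs" "same_order zs p" using assms by (auto simp: contains_def)
  obtain f where f: "strict_mono_on (set xs) f" "ys = map f xs"
    by (rule same_order_obtain_map[OF assms(2)])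
  have "set zs \<subseteq> set xs" using zs(1) by (rule set_subseq)
  then have "same_order (map f zs) zs"
    by (intro same_order_map) (use f(1) in \<open>auto simp: strict_mono_on_def\<close>)
  then show ?thesis unfolding contains_def f(2)
    using zs same_order_trans subseq_map by blast
qed

lemma contains_subseq: "contains xs p \<Longrightarrow> subseq xs ys \<Longrightarrow> contains ys p"
  unfolding contains_def by (meson subseq_order.order_trans)

lemma contains_trans: "contains xs ys \<Longrightarrow> contains ys zs \<Longrightarrow> contains xs zs"
  by (metis contains_def contains_same_order contains_subseq same_order_sym)

lemma contains_same_order_right: "contains xs p \<Longrightarrow> same_order p q \<Longrightarrow> contains xs q"
  unfolding contains_def by (meson same_order_trans)

lemma subseq_rev:
  assumes "subseq xs ys"
  shows "subseq (rev xs) (rev ys)"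
  using assms
proof (induction rule: list_emb.induct)
  case (list_emb_Cons2 x y xs ys)
  then show ?case by (simp add: list_emb_append_mono)
qed auto

lemma contains_rev: "contains xs p \<Longrightarrow> contains (rev xs) (rev p)"
  unfolding contains_def using same_order_rev subseq_rev by blast

section \<open>Occurrences of three-letter patterns\<close>

lemma contains_iff_subseq3:
  "contains w [p, q, r] \<longleftrightarrow> (\<exists>a b c. subseq [a, b, c] w \<and> same_order [a, b, c] [p, q, r])"
proof
  assume "contains w [p, q, r]"
  then obtain zs where zs: "subseq zs w" "same_order zs [p, q, r]" by (auto simp: contains_def)
  from same_order_length[OF zs(2)] obtain a b c where "zs = [a, b, c]"
    by (auto simp: length_Suc_conv)
  with zs show "\<exists>a b c. subseq [a, b, c] w \<and> same_order [a, b, c] [p, q, r]" by blast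
qed (auto simp: contains_def)

lemma contains_231_iff: "contains w [2, 3, 1] \<longleftrightarrow> (\<exists>a b c. subseq [b, c, a] w \<and> a < b \<and> b < c)"
proof -
  have "same_order [b, c, a] [2, 3, 1] \<longleftrightarrow> a < b \<and> b < c" for a b c by auto
  then show ?thesis unfolding contains_iff_subseq3 by metis
qed

lemma contains_231_Cons:
  "contains (x # w) [2, 3, 1] \<longleftrightarrow>
     contains w [2, 3, 1] \<or> (\<exists>a c. subseq [c, a] w \<and> a < x \<and> x < c)"
proof
  assume "contains (x # w) [2, 3, 1]"
  then obtain a b c where abc: "subseq [b, c, a] (x # w)" "a < b" "b < c"
    unfolding contains_231_iff by blast
  from abc(1) show "contains w [2, 3, 1] \<or> (\<exists>a c. subseq [c, a] w \<and> a < x \<and> x < c)"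
    by cases (use abc(2,3) contains_231_iff in blast)+
next
  assume "contains w [2, 3, 1] \<or> (\<exists>a c. subseq [c, a] w \<and> a < x \<and> x < c)"
  then show "contains (x # w) [2, 3, 1]"
  proof
    assume "\<exists>a c. subseq [c, a] w \<and> a < x \<and> x < c"
    then show ?thesis unfolding contains_231_iff by (meson subseq_Cons2)
  qed (auto elim: contains_subseq)
qed

text \<open>A head can only play the role of 2, which requires both a smaller and a larger entry
  after it; an extreme head lacks one of them.\<close>

lemma contains_231_Cons_min:
  assumes "\<forall>y\<in>set w. x \<le> y"
  shows "contains (x # w) [2, 3, 1] \<longleftrightarrow> contains w [2, 3, 1]"
  using assms set_subseq[of _ w] unfolding contains_231_Cons by fastforce

lemma contains_231_Cons_max:
  assumes "\<forall>y\<in>set w. y \<le> x"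
  shows "contains (x # w) [2, 3, 1] \<longleftrightarrow> contains w [2, 3, 1]"
  using assms set_subseq[of _ w] unfolding contains_231_Cons by fastforce

lemma contains_213_iff: "contains w [2, 1, 3] \<longleftrightarrow> (\<exists>a b c. subseq [b, a, c] w \<and> a < b \<and> b < c)"
proof -
  have "same_order [b, a, c] [2, 1, 3] \<longleftrightarrow> a < b \<and> b < c" for a b c by auto
  then show ?thesis unfolding contains_iff_subseq3 by metis
qed

lemma contains_132_rev: "contains (rev w) [1, 3, 2] \<longleftrightarrow> contains w [2, 3, 1]"
  using contains_rev[of w "[2, 3, 1]"] contains_rev[of "rev w" "[1, 3, 2]"] by auto

lemma perm_class_Av: "perm_class (Av P)"
  unfolding perm_class_def Av_def using contains_trans by blast

section \<open>Consecutive containment\<close>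

lemma contains_consec_same_order:
  assumes "contains_consec xs p" "same_order xs ys"
  shows "contains_consec ys p"
proof -
  obtain zs where zs: "sublist zs xs" "same_order zs p"
    using assms by (auto simp: contains_consec_def)
  obtain us vs where xs: "xs = us @ zs @ vs" using zs(1) by (auto simp: sublist_def)
  have "same_order (take (length zs) (drop (length us) xs)) (take (length zs) (drop (length us) ys))"
    using assms(2) by (intro same_order_take same_order_drop)
  then have "same_order (take (length zs) (drop (length us) ys)) p"
    using zs(2) unfolding xs by (auto simp: same_order_def)
  moreover have "sublist (take (length zs) (drop (length us) ys)) ys"
    by (metis sublist_drop sublist_order.order_trans sublist_take)
  ultimately show ?thesis unfolding contains_consec_def by blast
qed

lemma contains_consec_imp_contains: "contains_consec xs p \<Longrightarrow> contains xs p"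
  unfolding contains_consec_def contains_def by (meson sublist_imp_subseq)

lemma contains_consec_Nil: "p \<noteq> [] \<Longrightarrow> \<not> contains_consec [] p"
  by (auto simp: contains_consec_def)

lemma contains_consec_Cons:
  "contains_consec (x # xs) p \<longleftrightarrow>
     same_order (take (length p) (x # xs)) p \<or> contains_consec xs p"
proof -
  have "(\<exists>zs. prefix zs (x # xs) \<and> same_order zs p) \<longleftrightarrow> same_order (take (length p) (x # xs)) p"
    by (metis append_eq_conv_conj prefix_def same_order_length take_is_prefix)
  then show ?thesis unfolding contains_consec_def sublist_Cons_right by blast
qed

lemma contains_consec_short: "length xs < length p \<Longrightarrow> \<not> contains_consec xs p"
  unfolding contains_consec_def by (metis leD same_order_length sublist_length_le)


section \<open>The stack procedure\<close>

text \<open>Since the stack avoids \<open>\<sigma>\<close> at all times, pushing an entry can only create an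
  occurrence of \<open>\<sigma>\<close> at the very top.\<close>

definition blocked :: "nat list \<Rightarrow> nat \<Rightarrow> nat list \<Rightarrow> bool" where
  "blocked \<sigma> x st \<longleftrightarrow> same_order (take (length \<sigma>) (x # st)) \<sigma>"

text \<open>Only the top window is tested, a push onto an empty stack always succeeds, and the stack
  is emptied at once when the input ends. This form has no undefined case.\<close>

function sc_run :: "nat list \<Rightarrow> nat list \<Rightarrow> nat list \<Rightarrow> nat list" where
  "sc_run \<sigma> [] st = st"
| "sc_run \<sigma> (x # inp) [] = sc_run \<sigma> inp [x]"
| "sc_run \<sigma> (x # inp) (s # st) =
     (if blocked \<sigma> x (s # st) then s # sc_run \<sigma> (x # inp) st else sc_run \<sigma> inp (x # s # st))"
  by pat_completeness auto
termination
  by (relation "measure (\<lambda>(\<sigma>, inp, st). 2 * length inp + length st)") auto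

lemma not_blocked_short: "length st + 1 < length \<sigma> \<Longrightarrow> \<not> blocked \<sigma> x st"
  unfolding blocked_def by (auto dest!: same_order_length)

lemma sc_run_push: "\<not> blocked \<sigma> x st \<Longrightarrow> sc_run \<sigma> (x # inp) st = sc_run \<sigma> inp (x # st)"
  by (cases st) auto

lemma contains_consec_Cons_blocked:
  "contains_consec (x # st) \<sigma> \<longleftrightarrow> blocked \<sigma> x st \<or> contains_consec st \<sigma>"
  by (simp only: contains_consec_Cons blocked_def)

text \<open>Consecutive containment depends only on relative order, and the standardization of
  \<open>w\<close> is the witness from \<open>perms\<close>.\<close>

lemma ex_allowed_iff:
  assumes "distinct w"
  shows "(\<exists>\<tau>\<in>{\<tau> \<in> perms. \<not> contains_consec \<tau> \<sigma>}. same_order w \<tau>) \<longleftrightarrow> \<not> contains_consec w \<sigma>"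
proof
  assume "\<not> contains_consec w \<sigma>"
  then have "\<not> contains_consec (standardize w) \<sigma>"
    using contains_consec_same_order same_order_standardize by blast
  then show "\<exists>\<tau>\<in>{\<tau> \<in> perms. \<not> contains_consec \<tau> \<sigma>}. same_order w \<tau>"
    using same_order_sym[OF same_order_standardize] permsI_standardize[OF assms] by blast
qed (use contains_consec_same_order in blast)

lemma stack_run_step:
  assumes "distinct (x # st)"
  shows "stack_run {\<tau> \<in> perms. \<not> contains_consec \<tau> \<sigma>} (x # inp) st =
    (if contains_consec (x # st) \<sigma>
     then (case st of [] \<Rightarrow> []
       | s # st' \<Rightarrow> s # stack_run {\<tau> \<in> perms. \<not> contains_consec \<tau> \<sigma>} (x # inp) st')
     else stack_run {\<tau> \<in> perms. \<not> contains_consec \<tau> \<sigma>} inp (x # st))"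
  by (subst stack_run.simps(3), subst ex_allowed_iff[OF assms]) (simp del: stack_run.simps)

text \<open>As the stack always avoids \<sigma>, a push is forbidden exactly when it is
  \<open>blocked\<close>. Length at least 2 lets any entry onto an empty stack, so the arbitrary
  value never arises.\<close>

lemma stack_run_eq_sc_run:
  assumes "2 \<le> length \<sigma>" "distinct (inp @ st)" "\<not> contains_consec st \<sigma>"
  shows "stack_run {\<tau> \<in> perms. \<not> contains_consec \<tau> \<sigma>} inp st = sc_run \<sigma> inp st"
  using assms
proof (induction \<sigma> inp st rule: sc_run.induct)
  case (1 \<sigma> st)
  have "stack_run A [] st = st" for A by (induction st) auto
  then show ?case by simp
next
  case (2 \<sigma> x inp)
  have nc: "\<not> contains_consec [x] \<sigma>" using 2 by (intro contains_consec_short) auto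
  have d: "distinct [x]" by simp
  show ?case using 2 nc
    by (simp add: stack_run_step[OF d] del: stack_run.simps)
next
  case (3 \<sigma> x inp s st)
  have d: "distinct (x # s # st)" using 3 by simp
  show ?case
  proof (cases "blocked \<sigma> x (s # st)")
    case True
    then have "contains_consec (x # s # st) \<sigma>" by (simp add: contains_consec_Cons_blocked)
    moreover have "\<not> contains_consec st \<sigma>" using 3 by (simp add: contains_consec_Cons_blocked)
    ultimately show ?thesis using 3 True
      by (simp add: stack_run_step[OF d] del: stack_run.simps)
  next
    case False
    then have "\<not> contains_consec (x # s # st) \<sigma>"
      using 3(5) by (subst contains_consec_Cons_blocked) simp
    then show ?thesis using 3 False
      by (simp add: stack_run_step[OF d] del: stack_run.simps)
  qed
qed

lemma SC_eq_sc_run: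
  assumes "2 \<le> length \<sigma>" "distinct \<pi>"
  shows "SC \<sigma> \<pi> = sc_run \<sigma> \<pi> []"
  unfolding SC_def T_def
  by (rule stack_run_eq_sc_run) (use assms contains_consec_short[of "[]" \<sigma>] in \<open>auto simp del: length_greater_0_conv\<close>)

lemma mset_sc_run: "mset (sc_run \<sigma> inp st) = mset inp + mset st"
  by (induction \<sigma> inp st rule: sc_run.induct) auto

lemma set_sc_run: "set (sc_run \<sigma> inp st) = set inp \<union> set st"
  using mset_sc_run[of \<sigma> inp st] by (metis set_mset_mset set_mset_union)

text \<open>Entries on the stack leave from top to bottom; later entries only interleave with
  them.\<close>

lemma subseq_sc_run: "subseq st (sc_run \<sigma> inp st)"
proof (induction \<sigma> inp st rule: sc_run.induct)
  case (3 \<sigma> x inp s st)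
  then show ?case using subseq_Cons'[of x "s # st"] by auto
qed auto

text \<open>Every intermediate stack is a suffix of the final one, so avoidance by the final stack
  rules out every refusal.\<close>

lemma sc_run_push_all:
  assumes "\<not> contains_consec (rev inp @ st) \<sigma>"
  shows "sc_run \<sigma> (inp @ rest) st = sc_run \<sigma> rest (rev inp @ st)"
  using assms
proof (induction inp arbitrary: st)
  case (Cons x inp)
  have "\<not> contains_consec (x # st) \<sigma>"
    using Cons.prems unfolding contains_consec_def
    by simp (meson sublist_append_leftI sublist_order.order_trans)
  then have "\<not> blocked \<sigma> x st" by (simp add: contains_consec_Cons_blocked)
  then show ?case using Cons by (simp add: sc_run_push)
qed simp

lemma sc_run_avoiding:
  "\<not> contains_consec w \<sigma> \<Longrightarrow> sc_run \<sigma> (rev w) [] = w"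
  using sc_run_push_all[of "rev w" "[]" \<sigma> "[]"] by simp

lemma sc_run_blocked_contains_swap:
  assumes "blocked (a # b # \<sigma>) x st"
  shows "contains (sc_run (a # b # \<sigma>) (x # inp) st) (b # a # \<sigma>)"
  using assms
proof (induction st)
  case Nil
  then show ?case by (simp add: blocked_def)
next
  case (Cons s st)
  show ?case
  proof (cases "blocked (a # b # \<sigma>) x st")
    case True
    then show ?thesis using Cons contains_subseq[of _ "b # a # \<sigma>" "s # _"] by auto
  next
    case False
    \<comment> \<open>Here \<open>s\<close> is the last entry popped: it is output, then
      \<open>x\<close> goes onto \<open>st\<close>, and what \<open>x\<close> now covers is output
      later in stack order.\<close>
    have so: "same_order (x # s # take (length \<sigma>) st) (a # b # \<sigma>)"
      using Cons.prems by (simp add: blocked_def)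
    then have "same_order (s # x # take (length \<sigma>) st) (b # a # \<sigma>)" by auto
    moreover have "subseq (x # take (length \<sigma>) st) (sc_run (a # b # \<sigma>) inp (x # st))"
      by (rule subseq_order.order_trans[OF _ subseq_sc_run])
        (simp add: prefix_imp_subseq take_is_prefix)
    then have "subseq (s # x # take (length \<sigma>) st) (sc_run (a # b # \<sigma>) (x # inp) (s # st))"
      using Cons.prems False by (simp add: sc_run_push)
    ultimately show ?thesis unfolding contains_def by blast
  qed
qed

text \<open>Either no entry is refused and the stack ends as \<open>rev inp @ st\<close>, or the
  first refusal already produces the swapped pattern.\<close>

lemma sc_run_dichotomy:
  assumes "\<not> contains_consec st (a # b # \<sigma>)"
  shows "\<not> contains_consec (rev inp @ st) (a # b # \<sigma>) \<or>
    contains (sc_run (a # b # \<sigma>) inp st) (b # a # \<sigma>)"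
  using assms
proof (induction inp arbitrary: st)
  case (Cons x inp)
  show ?case
  proof (cases "blocked (a # b # \<sigma>) x st")
    case True
    then show ?thesis using sc_run_blocked_contains_swap by blast
  next
    case False
    then have "\<not> contains_consec (x # st) (a # b # \<sigma>)"
      using Cons.prems by (simp add: contains_consec_Cons_blocked)
    from Cons.IH[OF this] False show ?thesis by (simp add: sc_run_push)
  qed
qed simp

text \<open>The procedure only compares entries, so it commutes with increasing
  relabellings.\<close>

lemma sc_run_map:
  assumes "strict_mono_on (set inp \<union> set st) f"
  shows "sc_run \<sigma> (map f inp) (map f st) = map f (sc_run \<sigma> inp st)"
  using assms
proof (induction \<sigma> inp st rule: sc_run.induct)
  case (3 \<sigma> x inp s st)
  have "set (take (length \<sigma>) (x # s # st)) \<subseteq> set (x # inp) \<union> set (s # st)"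
    using set_take_subset[of "length \<sigma>" "x # s # st"] by auto
  then have "same_order (map f (take (length \<sigma>) (x # s # st))) (take (length \<sigma>) (x # s # st))"
    using 3(3) monotone_on_subset by (intro same_order_map) blast
  then have b: "blocked \<sigma> (f x) (f s # map f st) \<longleftrightarrow> blocked \<sigma> x (s # st)"
    unfolding blocked_def same_order_def by (metis list.map take_map)
  have m: "strict_mono_on (set (x # inp) \<union> set st) f" "strict_mono_on (set inp \<union> set (x # s # st)) f"
    using 3(3) by (auto simp: strict_mono_on_def)
  show ?case
    using 3(1)[OF _ m(1)] 3(2)[OF _ m(2)] b by auto
qed auto

lemma sc_run_same_order:
  assumes "same_order u v"
  shows "same_order (sc_run \<sigma> u []) (sc_run \<sigma> v [])"
proof -
  obtain f where f: "strict_mono_on (set u) f" "v = map f u"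
    by (rule same_order_obtain_map[OF assms])
  then show ?thesis
    using sc_run_map[of u "[]" f \<sigma>] same_order_map[of "sc_run \<sigma> u []" f]
    by (auto simp: set_sc_run intro: same_order_sym)
qed

section \<open>Sortable words\<close>

text \<open>Defined for arbitrary words, so that counterexamples may use entries such as 0 or
  \<open>k + 1\<close>.\<close>

definition sortable :: "nat list \<Rightarrow> nat list \<Rightarrow> bool" where
  "sortable \<sigma> w \<longleftrightarrow> \<not> contains (sc_run \<sigma> w []) [2, 3, 1]"

lemma perms_distinct: "\<pi> \<in> perms \<Longrightarrow> distinct \<pi>"
  by (auto simp: perms_def Sym_def permutations_of_set_def)

lemma perms_mset: "\<pi> \<in> perms \<Longrightarrow> mset \<rho> = mset \<pi> \<Longrightarrow> \<rho> \<in> perms"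
  unfolding perms_def Sym_def permutations_of_set_def
  by simp (metis mset_eq_imp_distinct_iff mset_eq_setD)

lemma Sort_SC_iff:
  assumes "2 \<le> length \<sigma>"
  shows "\<pi> \<in> Sort (SC \<sigma>) \<longleftrightarrow> \<pi> \<in> perms \<and> sortable \<sigma> \<pi>"
proof (cases "\<pi> \<in> perms")
  case True
  then have "SC \<sigma> \<pi> = sc_run \<sigma> \<pi> []" by (simp add: assms SC_eq_sc_run perms_distinct)
  moreover have "sc_run \<sigma> \<pi> [] \<in> perms"
    using perms_mset[OF True] by (simp add: mset_sc_run)
  ultimately show ?thesis using True by (simp add: Sort_def Av_def sortable_def)
qed (simp add: Sort_def)

lemma sortable_same_order: "same_order u v \<Longrightarrow> sortable \<sigma> u \<longleftrightarrow> sortable \<sigma> v"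
  unfolding sortable_def by (meson contains_same_order same_order_sym sc_run_same_order)

text \<open>Standardizing both words gives permutations with the same sortability, one contained in
  the other.\<close>

lemma not_perm_classI:
  assumes \<sigma>: "2 \<le> length \<sigma>" and "distinct u" "distinct v" "contains v u"
    and v: "sortable \<sigma> v" and u: "\<not> sortable \<sigma> u"
  shows "\<not> perm_class (Sort (SC \<sigma>))"
proof
  assume cls: "perm_class (Sort (SC \<sigma>))"
  have "standardize v \<in> Sort (SC \<sigma>)"
    using v sortable_same_order[OF same_order_standardize, of \<sigma> v] permsI_standardize[OF assms(3)]
    by (simp add: Sort_SC_iff \<sigma>)
  moreover have "contains (standardize v) (standardize u)"
    by (meson assms(4) contains_same_order contains_same_order_right same_order_standardize same_order_sym)
  ultimately have "standardize u \<in> Sort (SC \<sigma>)"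
    using cls permsI_standardize[OF assms(2)] by (auto simp: perm_class_def)
  then show False
    using u sortable_same_order[OF same_order_standardize, of \<sigma> u] by (simp add: Sort_SC_iff \<sigma>)
qed

lemma sortable_avoiding:
  "\<not> contains_consec w \<sigma> \<Longrightarrow> sortable \<sigma> (rev w) \<longleftrightarrow> \<not> contains w [2, 3, 1]"
  by (simp add: sortable_def sc_run_avoiding)

section \<open>The pattern 12\<close>

lemma blocked_12: "blocked [Suc 0, 2] x (s # st) \<longleftrightarrow> x < s"
  by (auto simp: blocked_def)

text \<open>The stack decreases from top to bottom, so the minimum, once pushed, lies at the bottom,
  and no smaller entry comes to force it out.\<close>

lemma last_sc_run_12:
  assumes "sorted_wrt (>) st" "inp @ st \<noteq> []" "distinct (inp @ st)" "y \<in> set inp \<union> set st"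
  shows "last (sc_run [1, 2] inp st) \<le> y"
  using assms
proof (induction "[1::nat, 2]" inp st arbitrary: y rule: sc_run.induct)
  case (1 st)
  then show ?case by (induction st) (auto split: if_splits intro: less_imp_le)
next
  case (2 x inp)
  then show ?case by auto
next
  case (3 x inp s st)
  show ?case
  proof (cases "x < s")
    case True
    have "last (sc_run [1, 2] (x # inp) st) \<le> y" if "y \<in> set (x # inp) \<union> set st" for y
      using 3 True that by (simp add: blocked_12)
    \<comment> \<open>The popped \<open>s\<close> is no longer in the run, but the smaller
      \<open>x\<close> still is.\<close>
    moreover from this[of x] have "last (sc_run [1, 2] (x # inp) st) \<le> s" using True by simp
    moreover have "sc_run [1, 2] (x # inp) st \<noteq> []"
      using set_sc_run[of "[1, 2]" "x # inp" st] by force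
    ultimately show ?thesis using 3(6) True by (auto simp: blocked_12)
  next
    case False
    then have "\<forall>z\<in>set st. z < x" using 3 by fastforce
    then show ?thesis using 3 False by (auto simp: blocked_12)
  qed
qed

lemma sorted_wrt_subseq: "subseq xs ys \<Longrightarrow> sorted_wrt P ys \<Longrightarrow> sorted_wrt P xs"
  by (induction rule: list_emb.induct) (auto dest: list_emb_set)

lemma subseq_append_ConsE:
  assumes "subseq zs (us @ s # vs)"
  obtains "subseq zs (us @ vs)" | p q where "zs = p @ s # q" "subseq p us" "subseq q vs"
proof -
  obtain p q where pq: "zs = p @ q" "subseq p us" "subseq q (s # vs)"
    using assms by (auto simp: subseq_append_iff)
  from pq(3) show thesis
  proof cases
    case list_emb_Cons
    then show ?thesis using pq that(1) by (simp add: list_emb_append_mono)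
  qed (use pq that in auto)
qed

text \<open>Reading the stack from bottom to top in front of the remaining input makes a push leave the
  word unchanged.\<close>

lemma sc_run_12_decreasing_iff:
  assumes "sorted_wrt (>) st" "distinct (inp @ st)"
  shows "sorted_wrt (>) (sc_run [1, 2] inp st) \<longleftrightarrow> \<not> contains (rev st @ inp) [2, 1, 3]"
  using assms
proof (induction "[1::nat, 2]" inp st rule: sc_run.induct)
  case (1 st)
  have "\<not> contains (rev st) [2, 1, 3]"
  proof
    assume "contains (rev st) [2, 1, 3]"
    then obtain a b c where abc: "subseq [b, a, c] (rev st)" "a < b"
      unfolding contains_213_iff by blast
    have "sorted_wrt (<) (rev st)" using 1 by (simp add: sorted_wrt_rev)
    from sorted_wrt_subseq[OF abc(1) this] abc(2) show False by simp
  qed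
  then show ?case using 1 by simp
next
  case (2 x inp)
  then show ?case by simp
next
  case (3 x inp s st)
  show ?case
  proof (cases "x < s")
    case False
    then have "\<forall>z\<in>set st. z < x" using 3 by fastforce
    then show ?thesis using 3 False by (auto simp: blocked_12)
  next
    case True
    \<comment> \<open>Outputting \<open>s\<close> keeps the output decreasing only if all remaining
      input is below \<open>s\<close>. A larger \<open>y\<close> there would form the 213
      \<open>s\<close>, \<open>x\<close>, \<open>y\<close>.\<close>
    have "\<not> contains (rev (s # st) @ x # inp) [2, 1, 3] \<longleftrightarrow>
      \<not> contains (rev st @ x # inp) [2, 1, 3] \<and> (\<forall>y\<in>set inp. y < s)"
    proof (intro iffI conjI ballI)
      assume av: "\<not> contains (rev (s # st) @ x # inp) [2, 1, 3]"
      have "subseq (rev st @ x # inp) (rev (s # st) @ x # inp)"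
        unfolding rev.simps append_assoc by (rule list_emb_append_mono) auto
      then show "\<not> contains (rev st @ x # inp) [2, 1, 3]" using av contains_subseq by blast
      fix y assume y: "y \<in> set inp"
      have "subseq [s, x, y] (rev st @ s # x # inp)"
        using y by (auto intro!: list_emb_append2 simp: subseq_singleton_left)
      then have "\<not> s < y" using av True unfolding contains_213_iff by auto
      then show "y < s" using y 3(4) by auto
    next
      assume R: "\<not> contains (rev st @ x # inp) [2, 1, 3] \<and> (\<forall>y\<in>set inp. y < s)"
      show "\<not> contains (rev (s # st) @ x # inp) [2, 1, 3]"
      proof
        assume "contains (rev (s # st) @ x # inp) [2, 1, 3]"
        then obtain a b c where abc: "subseq [b, a, c] (rev st @ s # x # inp)" "a < b" "b < c"
          unfolding contains_213_iff by auto
        have srt: "sorted_wrt (<) (rev st)" using 3(3) by (simp add: sorted_wrt_rev)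
        from abc(1) show False
        proof (cases rule: subseq_append_ConsE)
          case 1
          then show ?thesis using R abc unfolding contains_213_iff by blast
        next
          case (2 p q)
          have low: "\<forall>z\<in>set (rev st). z < s" using 3(3) by auto
          have P: "sorted_wrt (<) p" "set p \<subseteq> set (rev st)"
            using sorted_wrt_subseq[OF 2(2) srt] set_subseq[OF 2(2)] by auto
          have Q: "set q \<subseteq> insert x (set inp)" using set_subseq[OF 2(3)] by auto
          \<comment> \<open>The part \<open>p\<close> before \<open>s\<close> lies in an increasing
            word below \<open>s\<close>. If it is empty, \<open>s\<close> is the 2 and nothing after
            it can be the 3; one entry would make \<open>s\<close> the 1 after a smaller 2; two
            entries would form a descent.\<close>
          show ?thesis
          proof (cases p)
            case Nil
            then have "b = s" "c \<in> set q" using 2(1) by auto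
            then show ?thesis using Q R True abc(3) by fastforce
          next
            case (Cons z p')
            show ?thesis
            proof (cases p')
              case Nil
              then have "a = s" "b \<in> set p" using 2(1) Cons by auto
              then show ?thesis using P(2) low abc(2) by fastforce
            next
              case (Cons z' p'')
              then have "p = b # a # p''" using 2(1) \<open>p = z # p'\<close> by simp
              then show ?thesis using P(1) abc(2) by simp
            qed
          qed
        qed
      qed
    qed
    moreover have "sorted_wrt (>) (sc_run [1, 2] (x # inp) (s # st)) \<longleftrightarrow>
       (\<forall>y\<in>set inp. y < s) \<and> sorted_wrt (>) (sc_run [1, 2] (x # inp) st)"
      using True 3(3) by (auto simp: blocked_12 set_sc_run)
    ultimately show ?thesis using 3 True by (auto simp: blocked_12)
  qed
qed

lemma not_decreasing_obtain_ascent: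
  assumes "distinct w" "\<not> sorted_wrt (>) w"
  obtains b c :: nat where "subseq [b, c] w" "b < c"
  using assms
proof (induction w arbitrary: thesis)
  case (Cons x w)
  show ?case
  proof (cases "sorted_wrt (>) w")
    case True
    then obtain y where "y \<in> set w" "\<not> y < x" using Cons.prems by auto
    moreover have "y \<noteq> x" using Cons.prems(2) calculation by auto
    ultimately have "subseq [x, y] (x # w)" "x < y" by (simp_all add: subseq_singleton_left)
    then show ?thesis by (rule Cons.prems)
  next
    case False
    have "distinct w" using Cons.prems(2) by simp
    from Cons.IH[OF _ this False] obtain b c where "subseq [b, c] w" "b < c" .
    then show ?thesis using Cons.prems(1) list_emb_Cons by blast
  qed
qed simp

lemma sortable_12_iff:
  assumes "distinct \<pi>"
  shows "sortable [1, 2] \<pi> \<longleftrightarrow> \<not> contains \<pi> [2, 1, 3]"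
proof -
  define w where "w = sc_run [1, 2] \<pi> []"
  have d: "distinct w"
    using mset_sc_run[of "[1, 2]" \<pi> "[]"] assms mset_eq_imp_distinct_iff by (auto simp: w_def)
  have "\<not> contains w [2, 3, 1] \<longleftrightarrow> sorted_wrt (>) w"
  proof
    assume "sorted_wrt (>) w"
    then show "\<not> contains w [2, 3, 1]"
      unfolding contains_231_iff using sorted_wrt_subseq by fastforce
  next
    assume av: "\<not> contains w [2, 3, 1]"
    show "sorted_wrt (>) w"
    proof (cases w rule: rev_cases)
      case (snoc w' m)
      have "\<pi> \<noteq> []" using snoc by (auto simp: w_def)
      then have "m \<le> y" if "y \<in> set w" for y
        using last_sc_run_12[of "[]" \<pi> y] that snoc assms by (simp add: w_def set_sc_run)
      then have m: "m < y" if "y \<in> set w'" for y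
        using that snoc d by (metis Un_iff disjoint_insert(1) distinct_append le_neq_implies_less
            list.simps(15) set_append)
      have "sorted_wrt (>) w'"
      proof (rule ccontr)
        assume "\<not> sorted_wrt (>) w'"
        then obtain b c where bc: "subseq [b, c] w'" "b < c"
          using not_decreasing_obtain_ascent d snoc by (metis distinct_append)
        \<comment> \<open>The minimum at the end turns any earlier ascent into a 231.\<close>
        have "subseq [b, c, m] w"
          using list_emb_append_mono[OF bc(1), of "[m]" "[m]"] snoc by simp
        moreover have "m < b" using m set_subseq[OF bc(1)] by simp
        ultimately show False using av bc(2) unfolding contains_231_iff by blast
      qed
      then show ?thesis using m snoc by (simp add: sorted_wrt_append)
    qed simp
  qed
  also have "sorted_wrt (>) w \<longleftrightarrow> \<not> contains \<pi> [2, 1, 3]"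
    using sc_run_12_decreasing_iff[of "[]" \<pi>] assms by (simp add: w_def)
  finally show ?thesis by (simp add: sortable_def w_def)
qed

lemma Sort_SC_12: "Sort (SC [1, 2]) = Av {[2, 1, 3]}"
  by (rule set_eqI) (use Sort_SC_iff[of "[1, 2]"] sortable_12_iff perms_distinct in \<open>auto simp: Av_def\<close>)

section \<open>Both patterns contain 231\<close>

text \<open>If the reversed input contains the pattern consecutively, both sides fail: the pattern
  brings a 132 into the input, the swapped pattern a 231 into the output. Otherwise the output is
  the reversed input.\<close>

lemma sortable_iff_avoids_132:
  assumes "contains (a # b # \<sigma>) [2, 3, 1]" "contains (b # a # \<sigma>) [2, 3, 1]"
  shows "sortable (a # b # \<sigma>) \<pi> \<longleftrightarrow> \<not> contains \<pi> [1, 3, 2]"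
proof (cases "contains_consec (rev \<pi>) (a # b # \<sigma>)")
  case True
  then have "contains (rev \<pi>) [2, 3, 1]"
    using assms(1) contains_consec_imp_contains contains_trans by blast
  then have "contains \<pi> [1, 3, 2]" using contains_132_rev[of "rev \<pi>"] by simp
  moreover have "contains (sc_run (a # b # \<sigma>) \<pi> []) (b # a # \<sigma>)"
    using sc_run_dichotomy[of "[]" a b \<sigma> \<pi>] True contains_consec_Nil by auto
  ultimately show ?thesis using assms(2) contains_trans unfolding sortable_def by blast
next
  case False
  then show ?thesis
    using sortable_avoiding[OF False] contains_132_rev[of "rev \<pi>"] by simp
qed

section \<open>Patterns for which the sortable permutations are not a class\<close>

text \<open>The stack is too short to refuse anything before \<open>x\<close>, and again once
  \<open>y\<close> is gone, so \<open>y\<close> is the only entry popped up to the push of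
  \<open>x\<close>.\<close>

lemma sc_run_pattern:
  assumes "same_order (x # y # zs) (a # b # \<sigma>)"
  shows "sc_run (a # b # \<sigma>) (rev (x # y # zs) @ rest) [] = y # sc_run (a # b # \<sigma>) rest (x # zs)"
proof -
  have len: "length zs = length \<sigma>" using same_order_length[OF assms] by simp
  have "\<not> contains_consec (y # zs) (a # b # \<sigma>)" by (rule contains_consec_short) (simp add: len)
  then have "sc_run (a # b # \<sigma>) (rev (y # zs) @ x # rest) [] =
      sc_run (a # b # \<sigma>) (x # rest) (y # zs)"
    using sc_run_push_all[of "rev (y # zs)" "[]" "a # b # \<sigma>" "x # rest"] by simp
  moreover have "blocked (a # b # \<sigma>) x (y # zs)" using assms by (simp add: blocked_def len)
  moreover have "\<not> blocked (a # b # \<sigma>) x zs" by (rule not_blocked_short) (simp add: len)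
  ultimately show ?thesis by (simp add: sc_run_push)
qed

lemma sc_run_rev_self: "sc_run (a # b # \<sigma>) (rev (a # b # \<sigma>)) [] = b # a # \<sigma>"
  using sc_run_pattern[of a b \<sigma> a b \<sigma> "[]"] by simp

lemma Sym_D: "\<sigma> \<in> Sym k \<Longrightarrow> distinct \<sigma> \<and> set \<sigma> = {1..k} \<and> length \<sigma> = k"
  by (auto simp: Sym_def permutations_of_set_def dest: distinct_card)

lemma Sym_bounds: "\<sigma> \<in> Sym k \<Longrightarrow> x \<in> set \<sigma> \<Longrightarrow> 1 \<le> x \<and> x \<le> k"
  using Sym_D by fastforce

text \<open>A consecutive occurrence in a three-letter stack would have to be the whole word, so no
  entry is refused and the output is 231.\<close>

lemma not_sortable_132:
  assumes "\<sigma> \<in> Sym k" "3 \<le> k" "\<sigma> \<noteq> [2, 3, 1]"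
  shows "\<not> sortable \<sigma> [1, 3, 2]"
proof -
  have k: "length \<sigma> = k" using Sym_D assms(1) by blast
  have S: "[2, 3, 1] \<in> Sym 3" by (auto simp: Sym_def permutations_of_set_def)
  have "\<not> same_order [2, 3, 1] \<sigma>"
    using standardize_Sym[OF S] standardize_Sym[OF assms(1)] assms(3) by (simp add: same_order_def)
  moreover have "\<not> contains_consec [3, 1] \<sigma>"
    by (rule contains_consec_short) (use k assms(2) in simp)
  ultimately have "\<not> contains_consec [2, 3, 1] \<sigma>"
    using contains_consec_Cons[of 2 "[3, 1]" \<sigma>] k assms(2) by (simp del: same_order_Cons)
  then show ?thesis using sortable_avoiding[of "[2, 3, 1]" \<sigma>] contains_refl by simp
qed

text \<open>The 5 drives 3 out ahead of 2; without it, 2, 3, 1 appears in the output.\<close>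

lemma not_perm_class_21: "\<not> perm_class (Sort (SC [2, 1]))"
proof (rule not_perm_classI)
  have run: "sc_run [2, 1] [3, 5, 2, 4, 1] [] = [3, 2, 1, 4, 5]" by (simp add: blocked_def)
  show "sortable [2, 1] [3, 5, 2, 4, 1]"
    unfolding sortable_def run contains_231_iff by (auto split: if_splits)
  have run: "sc_run [2, 1] [3, 2, 4, 1] [] = [2, 3, 1, 4]" by (simp add: blocked_def)
  show "\<not> sortable [2, 1] [3, 2, 4, 1]"
    unfolding sortable_def run contains_231_iff not_not
    by (intro exI[of _ 1] exI[of _ 2] exI[of _ 3]) simp
  have "subseq [3, 2, 4, 1] [3, 5, 2, 4, 1::nat]" by simp
  then show "contains [3, 5, 2, 4, 1] [3, 2, 4, 1]" using contains_def same_order_refl by blast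
qed auto

text \<open>This pattern sorts 132 to 321, so another pair is needed. The inserted 3 is refused
  above 5, 2 and sends 5 out first, which breaks the occurrence 4, 5, 2.\<close>

lemma not_perm_class_231: "\<not> perm_class (Sort (SC [2, 3, 1]))"
proof (rule not_perm_classI)
  have run: "sc_run [2, 3, 1] [2, 5, 3, 1, 4] [] = [5, 4, 1, 3, 2]" by (simp add: blocked_def)
  show "sortable [2, 3, 1] [2, 5, 3, 1, 4]"
    unfolding sortable_def run contains_231_iff by (auto split: if_splits)
  have run: "sc_run [2, 3, 1] [2, 5, 1, 4] [] = [4, 1, 5, 2]" by (simp add: blocked_def)
  show "\<not> sortable [2, 3, 1] [2, 5, 1, 4]"
    unfolding sortable_def run contains_231_iff not_not
    by (intro exI[of _ 2] exI[of _ 4] exI[of _ 5]) simp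
  have "subseq [2, 5, 1, 4] [2, 5, 3, 1, 4::nat]" by simp
  then show "contains [2, 5, 3, 1, 4] [2, 5, 1, 4]" using contains_def same_order_refl by blast
qed auto

text \<open>Without the 1 the output is the reversed input 3, 4, 2. The 1 is refused above 4, 2 and
  sends 4 out first.\<close>

lemma not_perm_class_132: "\<not> perm_class (Sort (SC [1, 3, 2]))"
proof (rule not_perm_classI)
  have run: "sc_run [1, 3, 2] [2, 4, 1, 3] [] = [4, 3, 1, 2]" by (simp add: blocked_def)
  show "sortable [1, 3, 2] [2, 4, 1, 3]"
    unfolding sortable_def run contains_231_iff by (auto split: if_splits)
  have run: "sc_run [1, 3, 2] [2, 4, 3] [] = [3, 4, 2]" by (simp add: blocked_def)
  show "\<not> sortable [1, 3, 2] [2, 4, 3]"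
    unfolding sortable_def run contains_231_iff not_not
    by (intro exI[of _ 2] exI[of _ 3] exI[of _ 4]) simp
  have "subseq [2, 4, 3] [2, 4, 1, 3::nat]" by simp
  then show "contains [2, 4, 1, 3] [2, 4, 3]" using contains_def same_order_refl by blast
qed auto

text \<open>The reversed pattern is sent to the swapped pattern, hence is sortable, yet it contains
  the unsortable 132.\<close>

lemma not_perm_class_swap_avoids:
  assumes Sym: "a # b # s \<in> Sym k" and k: "3 \<le> k" and ne: "a # b # s \<noteq> [2, 3, 1]"
    and c: "contains (a # b # s) [2, 3, 1]" and av: "\<not> contains (b # a # s) [2, 3, 1]"
  shows "\<not> perm_class (Sort (SC (a # b # s)))"
proof (rule not_perm_classI)
  show "\<not> sortable (a # b # s) [1, 3, 2]" by (rule not_sortable_132[OF Sym k ne])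
  show "sortable (a # b # s) (rev (a # b # s))"
    unfolding sortable_def sc_run_rev_self by (rule av)
  show "contains (rev (a # b # s)) [1, 3, 2]" by (simp only: contains_132_rev c)
  show "distinct (rev (a # b # s))" using Sym_D[OF Sym] by (simp only: distinct_rev)
qed auto

text \<open>Here the first two entries of the pattern are descending above some later entry; inserting
  a new minimum between them destroys every consecutive occurrence and creates no 231.\<close>

lemma not_perm_class_swap_contains:
  assumes Sym: "a # b # s \<in> Sym k"
    and av: "\<not> contains (a # b # s) [2, 3, 1]" and c: "contains (b # a # s) [2, 3, 1]"
  shows "\<not> perm_class (Sort (SC (a # b # s)))"
proof (rule not_perm_classI)
  have D: "distinct (a # b # s)" "0 \<notin> set (a # b # s)" using Sym_D[OF Sym] by auto
  show "distinct (rev (a # b # s))" "distinct (rev (a # 0 # b # s))" using D by auto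
  show "\<not> sortable (a # b # s) (rev (a # b # s))"
    unfolding sortable_def sc_run_rev_self using c by blast
  show "contains (rev (a # 0 # b # s)) (rev (a # b # s))"
    by (rule contains_rev) (auto simp: contains_def intro!: exI[of _ "a # b # s"])
  obtain p q r where pqr: "subseq [q, r, p] (b # a # s)" "p < q" "q < r"
    using c unfolding contains_231_iff by blast
  have nsub: "\<not> subseq [q, r, p] (a # b # s)" using av pqr unfolding contains_231_iff by blast
  \<comment> \<open>An occurrence destroyed by exchanging the first two entries uses both of them,
    as 2 and 3.\<close>
  have "q = b \<and> r = a \<and> p \<in> set s"
    using pqr(1) nsub by (auto split: if_splits simp: subseq_singleton_left dest: subseq_Cons')
  then have p: "b < a" "p < b" "p \<in> set s" using pqr by auto
  have "\<not> contains_consec (a # 0 # b # s) (a # b # s)"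
  proof -
    \<comment> \<open>The second entry 0 has nothing below it, whereas in the pattern
      \<open>p\<close> lies below \<open>b\<close>.\<close>
    have "\<not> same_order (a # 0 # take (length s) (b # s)) (a # b # s)"
    proof
      assume "same_order (a # 0 # take (length s) (b # s)) (a # b # s)"
      then have "list_all2 (\<lambda>x y. (0 < x \<longleftrightarrow> b < y) \<and> (x < 0 \<longleftrightarrow> y < b)) (take (length s) (b # s)) s"
        by simp
      then show False using p(2,3) by (auto simp: list_all2_conv_all_nth in_set_conv_nth)
    qed
    moreover have "\<not> contains_consec (b # s) (a # b # s)" by (rule contains_consec_short) simp
    ultimately show ?thesis using p(1) D by (simp add: contains_consec_Cons)
  qed
  moreover have "\<not> contains (a # 0 # b # s) [2, 3, 1]"
    \<comment> \<open>The 0 directly follows \<open>a\<close>, so it cannot be the 1 of an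
      occurrence starting at \<open>a\<close>.\<close>
    using av unfolding contains_231_Cons[of a] contains_231_Cons[of 0]
    by (auto split: if_splits)
  ultimately show "sortable (a # b # s) (rev (a # 0 # b # s))"
    using sortable_avoiding[of "a # 0 # b # s" "a # b # s"] by blast
qed auto

text \<open>In the reverse of \<open>1 # b # 0 # s\<close> the 0 takes the place of the 1 of
  \<sigma> and is popped when \<open>b\<close> arrives. The output then starts with its two smallest
  entries, although 1, \<open>b\<close>, 0 makes the input contain 132.\<close>

lemma not_perm_class_one_second:
  assumes Sym: "b # 1 # s \<in> Sym k" and k: "3 \<le> k" and av: "\<not> contains (b # 1 # s) [2, 3, 1]"
  shows "\<not> perm_class (Sort (SC (b # 1 # s)))"
proof (rule not_perm_classI)
  have "1 < x" if "x \<in> set (b # s)" for x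
    using Sym_bounds[OF Sym, of x] Sym_D[OF Sym] that by (cases "x = 1") auto
  then have D: "distinct (b # s)" "\<forall>x\<in>set (b # s). 1 < x"
    using Sym_D[OF Sym] by auto
  have "b # 1 # s \<noteq> [2, 3, 1]" by simp
  then show "\<not> sortable (b # 1 # s) [1, 3, 2]" using not_sortable_132[OF Sym k] by blast
  show "distinct (rev (1 # b # 0 # s))" using D by auto
  have "subseq [1, b, 0] (1 # b # 0 # s)" by simp
  then have "contains (1 # b # 0 # s) [2, 3, 1]" using D unfolding contains_231_iff by auto
  then show "contains (rev (1 # b # 0 # s)) [1, 3, 2]" by (simp only: contains_132_rev)
  have so: "same_order (b # 0 # s) (b # 1 # s)" using D(2) by (auto simp: list.rel_refl_strong list_all2_same)
  have "sc_run (b # 1 # s) (rev (1 # b # 0 # s)) [] = 0 # sc_run (b # 1 # s) [1] (b # s)"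
    using sc_run_pattern[OF so, of "[1]"] by simp
  also have "\<not> blocked (b # 1 # s) 1 (b # s)"
    using D(2) by (auto simp: blocked_def)
  then have "sc_run (b # 1 # s) [1] (b # s) = 1 # b # s" by (simp add: sc_run_push)
  finally have run: "sc_run (b # 1 # s) (rev (1 # b # 0 # s)) [] = 0 # 1 # b # s" .
  have "\<not> contains (b # s) [2, 3, 1]"
    using av contains_subseq[of "b # s" _ "b # 1 # s"] by auto
  then have "\<not> contains (0 # 1 # b # s) [2, 3, 1]"
    using D(2) contains_231_Cons_min[of "1 # b # s" 0] contains_231_Cons_min[of "b # s" 1] by force
  then show "sortable (b # 1 # s) (rev (1 # b # 0 # s))" unfolding sortable_def run .
qed auto

text \<open>The word \<open>rev \<sigma> @ [M]\<close> with \<open>M\<close> maximal is not sortable. One further entry inserted near the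
  end of \<open>rev \<sigma>\<close> removes the consecutive occurrence, which makes it sortable; where it can be inserted
  depends on whether the third entry of \<open>\<sigma>\<close> is 2. For \<open>\<sigma> = 132\<close> there is no such place.\<close>

lemma not_perm_class_one_first:
  assumes Sym: "1 # b # s \<in> Sym k" and k: "3 \<le> k" and av: "\<not> contains (1 # b # s) [2, 3, 1]"
  shows "\<not> perm_class (Sort (SC (1 # b # s)))"
proof -
  define M where "M = k + 1"
  have "1 < x \<and> x < M" if "x \<in> set (b # s)" for x
    using Sym_bounds[OF Sym, of x] Sym_D[OF Sym] that by (cases "x = 1") (auto simp: M_def)
  then have D: "distinct (b # s)" "\<forall>x\<in>set (b # s). 1 < x \<and> x < M" "length s + 2 = k" "1 < M"
    using Sym_D[OF Sym] k by (auto simp: M_def)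
  have avs: "\<not> contains (b # s) [2, 3, 1]" "\<not> contains s [2, 3, 1]"
    using av unfolding contains_231_Cons[of 1] contains_231_Cons[of b] by blast+
  have nM: "\<not> same_order (M # 1 # zs) (1 # b # s)" "\<not> same_order (M # b # zs) (1 # b # s)" for zs
    using D by auto
  have u: "distinct (rev (M # 1 # b # s))" using D by auto
  have "\<not> blocked (1 # b # s) M (1 # s)" using nM(1) by (simp add: blocked_def del: same_order_Cons)
  then have run: "sc_run (1 # b # s) (rev (M # 1 # b # s)) [] = b # M # 1 # s"
    using sc_run_pattern[of 1 b s 1 b s "[M]"] by (simp add: sc_run_push)
  \<comment> \<open>Only \<open>b\<close> leaves before \<open>M\<close> is pushed, so
    \<open>b\<close>, \<open>M\<close>, 1 come out as a 231.\<close>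
  have "subseq [b, M, 1] (b # M # 1 # s)" "1 < b" "b < M" using D(2) by auto
  then have "contains (b # M # 1 # s) [2, 3, 1]" unfolding contains_231_iff by blast
  then have uns: "\<not> sortable (1 # b # s) (rev (M # 1 # b # s))" unfolding sortable_def run by blast
  have not_class: ?thesis
    if "distinct v" "contains v (rev (M # 1 # b # s))" "sortable (1 # b # s) v" for v
    by (rule not_perm_classI[OF _ u that uns]) simp
  have "set (1 # b # s) = {1..k}" using Sym_D[OF Sym] by blast
  then have mem_23: "2 \<in> set (1 # b # s)" "3 \<in> set (1 # b # s)" using k by (simp_all del: list.set)
  obtain c s' where s: "s = c # s'" using D(3) k by (cases s) auto
  show ?thesis
  proof (cases "c = 2")
    case False
    have "\<not> contains_consec (M # 0 # b # 1 # s) (1 # b # s)"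
    proof -
      \<comment> \<open>In such a match \<open>b > 1\<close> forces \<open>b > c\<close>, so the
        entry 2 lies in \<open>s'\<close>, below \<open>c\<close>. Its partner in \<open>s\<close>
        would then be below 1, which is impossible.\<close>
      have "\<not> same_order (0 # b # 1 # take (length s') s) (1 # b # c # s')"
      proof
        assume so: "same_order (0 # b # 1 # take (length s') s) (1 # b # c # s')"
        have c: "2 < c" using D(2) s False by auto
        have "b \<noteq> 2" using so c D(2) by auto
        then have "2 \<in> set s'" using mem_23(1) s False by simp
        then obtain i where i: "i < length s'" "s' ! i = 2" by (auto simp: in_set_conv_nth)
        have "list_all2 (\<lambda>x y. (1 < x \<longleftrightarrow> c < y) \<and> (x < 1 \<longleftrightarrow> y < c)) (take (length s') s) s'"
          using so by simp
        from list_all2_nthD2[OF this i(1)] have "s ! i < 1" using i c by simp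
        moreover have "s ! i \<in> set s" using i(1) s by (intro nth_mem) simp
        ultimately show False using D(2) by fastforce
      qed
      moreover have "\<not> contains_consec (1 # s) (1 # b # s)" by (rule contains_consec_short) simp
      moreover have "\<not> same_order (b # 1 # zs) (1 # b # s)" for zs using D by auto
      moreover have "\<not> same_order (M # 0 # zs) (1 # b # s)" for zs using D by auto
      ultimately show ?thesis unfolding s
        by (simp add: contains_consec_Cons del: same_order_Cons)
    qed
    moreover have "\<not> contains (M # 0 # b # 1 # s) [2, 3, 1]"
    proof -
      have "\<not> contains (1 # s) [2, 3, 1]" using avs(2) D(2) contains_231_Cons_min[of s 1] by force
      then have "\<not> contains (b # 1 # s) [2, 3, 1]"
        using avs(1) D(2) unfolding contains_231_Cons[of b] by (auto split: if_splits)
      then show ?thesis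
        using D contains_231_Cons_max[of "0 # b # 1 # s" M] contains_231_Cons_min[of "b # 1 # s" 0]
        by force
    qed
    ultimately have "sortable (1 # b # s) (rev (M # 0 # b # 1 # s))"
      using sortable_avoiding[of "M # 0 # b # 1 # s" "1 # b # s"] by blast
    moreover have "same_order (M # 0 # b # s) (M # 1 # b # s)"
      using D(2,4) by (auto simp: list_all2_same)
    then have "contains (M # 0 # b # 1 # s) (M # 1 # b # s)"
      unfolding contains_def by (intro exI[of _ "M # 0 # b # s"]) auto
    then have "contains (rev (M # 0 # b # 1 # s)) (rev (M # 1 # b # s))" by (rule contains_rev)
    moreover have "distinct (rev (M # 0 # b # 1 # s))" using D by auto
    ultimately show ?thesis using not_class by blast
  next
    case True
    show ?thesis
    proof (cases s')
      case Nil
      then have "b = 3" using mem_23(2) s True by simp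
      then show ?thesis using not_perm_class_132 s True Nil by simp
    next
      case (Cons d s'')
      have "\<not> contains_consec (Suc M # 1 # M # b # s) (1 # b # s)"
      proof -
        \<comment> \<open>Since \<open>c = 2\<close>, a match would send the descent
          \<open>b\<close>, 2 to the ascent 2, \<open>d\<close>; this is where a fourth entry
          \<open>d\<close> is used.\<close>
        have "\<not> same_order (1 # M # b # take (length s') s) (1 # b # s)"
          using D(1,2) unfolding s Cons True by auto
        moreover have "\<not> contains_consec (b # s) (1 # b # s)" by (rule contains_consec_short) simp
        moreover have "\<not> same_order (Suc M # 1 # zs) (1 # b # s)" for zs using D by auto
        ultimately show ?thesis unfolding s using nM(2)[unfolded s]
          by (simp add: contains_consec_Cons del: same_order_Cons)
      qed
      moreover have "\<not> contains (Suc M # 1 # M # b # s) [2, 3, 1]"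
        using D avs(1) contains_231_Cons_max[of "1 # M # b # s" "Suc M"]
          contains_231_Cons_min[of "M # b # s" 1] contains_231_Cons_max[of "b # s" M]
        by force
      ultimately have "sortable (1 # b # s) (rev (Suc M # 1 # M # b # s))"
        using sortable_avoiding[of "Suc M # 1 # M # b # s" "1 # b # s"] by blast
      moreover have "same_order (Suc M # 1 # b # s) (M # 1 # b # s)"
        using D(2,4) by (auto simp: list_all2_same)
      then have "contains (Suc M # 1 # M # b # s) (M # 1 # b # s)"
        unfolding contains_def by (intro exI[of _ "Suc M # 1 # b # s"]) auto
      then have "contains (rev (Suc M # 1 # M # b # s)) (rev (M # 1 # b # s))" by (rule contains_rev)
      moreover have "distinct (rev (Suc M # 1 # M # b # s))" using D by auto
      ultimately show ?thesis using not_class by blast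
    qed
  qed
qed

text \<open>An entry of \<open>s\<close> below both \<open>a\<close> and \<open>b\<close> would
  complete a 231 in one of the two words. Hence 1 is one of the first two entries.\<close>

lemma not_perm_class_both_avoid:
  assumes Sym: "a # b # s \<in> Sym k" and k: "3 \<le> k"
    and av: "\<not> contains (a # b # s) [2, 3, 1]" "\<not> contains (b # a # s) [2, 3, 1]"
  shows "\<not> perm_class (Sort (SC (a # b # s)))"
proof -
  have min: "min a b \<le> x" if x: "x \<in> set s" for x
  proof (rule ccontr)
    assume "\<not> min a b \<le> x"
    then have lt: "x < a" "x < b" by auto
    have "a \<noteq> b" using Sym_D[OF Sym] by auto
    moreover have "subseq [a, b, x] (a # b # s)" "subseq [b, a, x] (b # a # s)"
      using x by (auto simp: subseq_singleton_left)
    ultimately show False using av lt unfolding contains_231_iff by (meson nat_neq_iff)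
  qed
  have "1 \<in> set (a # b # s)" using Sym_D[OF Sym] k by auto
  moreover have "1 \<le> a" "1 \<le> b" using Sym_bounds[OF Sym] by auto
  ultimately have "a = 1 \<or> b = 1" using min[of 1] by auto
  then show ?thesis
    using not_perm_class_one_first not_perm_class_one_second Sym k av(1) by blast
qed

theorem theorem2p2:
  shows "Sort (SC [1, 2]) = Av {[2, 1, 3]} \<and> perm_class (Av {[2, 1, 3]})
    \<and> \<not> perm_class (Sort (SC [2, 1]))
    \<and> (\<forall>k \<sigma>. 3 \<le> k \<longrightarrow> \<sigma> \<in> Sym k \<longrightarrow>
         (perm_class (Sort (SC \<sigma>)) \<longleftrightarrow>
            contains \<sigma> [2, 3, 1] \<and> contains (swap_first_two \<sigma>) [2, 3, 1])
       \<and> (contains \<sigma> [2, 3, 1] \<and> contains (swap_first_two \<sigma>) [2, 3, 1] \<longrightarrow>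
            Sort (SC \<sigma>) = Av {[1, 3, 2]}))"
proof (intro conjI[OF Sort_SC_12] conjI[OF perm_class_Av] conjI[OF not_perm_class_21] allI impI)
  fix k \<sigma> assume k: "3 \<le> (k::nat)" and Sym: "\<sigma> \<in> Sym k"
  obtain a b s where \<sigma>: "\<sigma> = a # b # s"
    using Sym_D[OF Sym] k by (cases \<sigma>; cases "tl \<sigma>") auto
  let ?both = "contains \<sigma> [2, 3, 1] \<and> contains (swap_first_two \<sigma>) [2, 3, 1]"
  have eq: "Sort (SC \<sigma>) = Av {[1, 3, 2]}" if ?both
    using that Sort_SC_iff[of \<sigma>] sortable_iff_avoids_132[of a b s] by (auto simp: \<sigma> Av_def)
  have "\<not> perm_class (Sort (SC \<sigma>))" if "\<not> ?both"
  proof (cases "\<sigma> = [2, 3, 1]")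
    case True
    then show ?thesis using not_perm_class_231 by simp
  next
    case False
    then show ?thesis
      using that not_perm_class_swap_avoids[of a b s k] not_perm_class_swap_contains[of a b s k]
        not_perm_class_both_avoid[of a b s k] Sym k
      unfolding \<sigma> swap_first_two.simps by blast
  qed
  then show "(perm_class (Sort (SC \<sigma>)) \<longleftrightarrow> ?both) \<and> (?both \<longrightarrow> Sort (SC \<sigma>) = Av {[1, 3, 2]})"
    using eq perm_class_Av by metis
qed

end
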